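(* In general, the regions $\mathcal{R}^{r}_{ref}$, $\mathcal{R}^{r}_{MS}$ and $\mathcal{R}^{r}_{AS}$ are not included in $\mathbb{C}_-$: there exists $r\in\mathbb{N}=\{0,1,2,\ldots\}$ such that $\mathcal{R}^{r}_{ref}\not\subset\mathbb{C}_-$, $\mathcal{R}^{r}_{MS}\not\subset\mathbb{C}_-$ and $\mathcal{R}^{r}_{AS}\not\subset\mathbb{C}_-$.
   Context: $\mathbb{C}_-=\{z\in\mathbb{C}\colon\Re(z)<0\}$. For $r\in\mathbb{N}$ (with $0\in\mathbb{N}$) and $z\in\mathbb{C}$ define $f_{r,z}\colon\mathbb{R}\to\mathbb{C}$ by $f_{r,z}(t)=\sum_{j=0}^{r+1}\frac{z^j}{j!}+\frac{t^{r+1}}{(r+1)!}z^{r+2}$. Let $\tau_1,\tau_2,\ldots$ be independent random variables, uniformly distributed on $[0,1]$, on a probability space $(\Omega,\Sigma,\mathbb{P})$, and fix $\eta\neq 0$. For $z\in\mathbb{C}$ put $v^r_k=v^r_k(z)=\eta\prod_{l=1}^k f_{r,z}(\tau_l)$, $k\in\mathbb{N}$. Define $\mathcal{R}^r_{MS}=\{z\in\mathbb{C}\colon v^r_k\to0 \text{ in } L^2(\Omega) \text{ as } k\to\infty\}$ (region of mean-square stability), $\mathcal{R}^r_{AS}=\{z\in\mathbb{C}\colon v^r_k\to0 \text{ almost surely as } k\to\infty\}$ (region of asymptotic stability), $\mathcal{R}^r_{ref}=\{z\in\mathbb{C}\colon |\sum_{j=0}^{r+2}\frac{z^j}{j!}|<1\}$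 (reference set). *)

theory Defs
  imports "HOL-Probability.Probability"
begin

definition left_half_plane :: "complex set" where
  "left_half_plane = {z. Re z < 0}"

definition rtaylor_f :: "nat \<Rightarrow> complex \<Rightarrow> real \<Rightarrow> complex" where
  "rtaylor_f r z t =
     (\<Sum>j=0..r+1. z ^ j / fact j) + of_real (t ^ (r+1) / fact (r+1)) * z ^ (r+2)"

(* The random variables are numbered from 1, so tau 0 never occurs and v at k = 0 is eta. *)
definition rtaylor_v ::
  "(nat \<Rightarrow> 'a \<Rightarrow> real) \<Rightarrow> complex \<Rightarrow> nat \<Rightarrow> complex \<Rightarrow> nat \<Rightarrow> 'a \<Rightarrow> complex" where
  "rtaylor_v \<tau> \<eta> r z k \<omega> = \<eta> * (\<Prod>l=1..k. rtaylor_f r z (\<tau> l \<omega>))"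

definition square_integrable :: "'a measure \<Rightarrow> ('a \<Rightarrow> complex) \<Rightarrow> bool" where
  "square_integrable M X \<longleftrightarrow>
     X \<in> borel_measurable M \<and> integrable M (\<lambda>\<omega>. (norm (X \<omega>))\<^sup>2)"

(* Square integrability is demanded explicitly because the Bochner integral of a
   non-integrable function is 0. *)
definition tendsto_L2 ::
  "'a measure \<Rightarrow> (nat \<Rightarrow> 'a \<Rightarrow> complex) \<Rightarrow> ('a \<Rightarrow> complex) \<Rightarrow> bool" where
  "tendsto_L2 M X Y \<longleftrightarrow>
     (\<forall>k. square_integrable M (X k)) \<and> square_integrable M Y \<and>
     (\<lambda>k. \<integral>\<omega>. (norm (X k \<omega> - Y \<omega>))\<^sup>2 \<partial>M) \<longlonglongrightarrow> 0"

definition region_MS ::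
  "'a measure \<Rightarrow> (nat \<Rightarrow> 'a \<Rightarrow> real) \<Rightarrow> complex \<Rightarrow> nat \<Rightarrow> complex set" where
  "region_MS M \<tau> \<eta> r = {z. tendsto_L2 M (rtaylor_v \<tau> \<eta> r z) (\<lambda>_. 0)}"

definition region_AS ::
  "'a measure \<Rightarrow> (nat \<Rightarrow> 'a \<Rightarrow> real) \<Rightarrow> complex \<Rightarrow> nat \<Rightarrow> complex set" where
  "region_AS M \<tau> \<eta> r = {z. AE \<omega> in M. (\<lambda>k. rtaylor_v \<tau> \<eta> r z k \<omega>) \<longlonglongrightarrow> 0}"

definition region_ref :: "nat \<Rightarrow> complex set" where
  "region_ref r = {z. norm (\<Sum>j=0..r+2. z ^ j / fact j) < 1}"

end

(* For r = 1 and z = \<i> one has |f(t)|^2 = 1/4 + (1 - t^2/2)^2, whose mean over [0,1] is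
   29/30 < 1.  By independence the mean square of v at step k is |\<eta>|^2 (29/30)^k; this tends
   to 0, and since it is summable, v tends to 0 almost surely as well. *)
theory Submission
  imports Defs
begin

lemma continuous_on_rtaylor_f: "continuous_on A (rtaylor_f r z)"
  unfolding rtaylor_f_def by (intro continuous_intros) auto

lemma norm_rtaylor_v_squared:
  "(norm (rtaylor_v \<tau> \<eta> r z k \<omega>))\<^sup>2 =
     (norm \<eta>)\<^sup>2 * (\<Prod>l=1..k. (norm (rtaylor_f r z (\<tau> l \<omega>)))\<^sup>2)"
  by (simp add: rtaylor_v_def norm_mult prod_norm[symmetric] power_mult_distrib prod_power_distrib)

text \<open>For nonnegative terms, summation and integration commute, so the pointwise series has a
  finite integral. It is therefore finite almost everywhere, and the terms of a convergent series
  tend to 0.\<close>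

lemma integral_suminf_AE_tendsto_0:
  fixes X :: "nat \<Rightarrow> 'a \<Rightarrow> real"
  assumes int: "\<And>k. integrable M (X k)"
    and nonneg: "\<And>k \<omega>. X k \<omega> \<ge> 0"
    and summ: "summable (\<lambda>k. \<integral>\<omega>. X k \<omega> \<partial>M)"
  shows "AE \<omega> in M. (\<lambda>k. X k \<omega>) \<longlonglongrightarrow> 0"
proof -
  have [measurable]: "X k \<in> borel_measurable M" for k
    using int by auto
  have "(\<integral>\<^sup>+\<omega>. (\<Sum>k. ennreal (X k \<omega>)) \<partial>M) = (\<Sum>k. \<integral>\<^sup>+\<omega>. ennreal (X k \<omega>) \<partial>M)"
    by (intro nn_integral_suminf) simp
  also have "\<dots> = (\<Sum>k. ennreal (\<integral>\<omega>. X k \<omega> \<partial>M))"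
    by (intro suminf_cong nn_integral_eq_integral int) (simp add: nonneg)
  also have "\<dots> = ennreal (\<Sum>k. \<integral>\<omega>. X k \<omega> \<partial>M)"
    by (intro suminf_ennreal2 summ) (simp add: nonneg)
  finally have "(\<integral>\<^sup>+\<omega>. (\<Sum>k. ennreal (X k \<omega>)) \<partial>M) \<noteq> \<infinity>"
    by simp
  then have "AE \<omega> in M. (\<Sum>k. ennreal (X k \<omega>)) \<noteq> \<infinity>"
    by (intro nn_integral_PInf_AE) simp_all
  then show ?thesis
    by eventually_elim (auto intro!: summable_LIMSEQ_zero summable_suminf_not_top nonneg)
qed

locale iid_uniform = prob_space M for M :: "'a measure" +
  fixes \<tau> :: "nat \<Rightarrow> 'a \<Rightarrow> real"
  assumes indep: "indep_vars (\<lambda>_. borel) \<tau> {1..}"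
    and uniform: "\<And>l. l \<ge> 1 \<Longrightarrow> distr M borel (\<tau> l) = uniform_measure lborel {0..1}"
begin

lemma measurable_tau: "l \<ge> 1 \<Longrightarrow> \<tau> l \<in> borel_measurable M"
  using indep by (auto simp: indep_vars_def)

text \<open>The fundamental theorem of calculus on [0,1], carried over to M along the law of
  \<open>\<tau> l\<close>.\<close>

lemma has_bochner_integral_tau:
  fixes g G :: "real \<Rightarrow> real"
  assumes "l \<ge> 1" and cont: "continuous_on UNIV g"
    and deriv: "\<And>t. (G has_real_derivative g t) (at t)"
  shows "has_bochner_integral M (\<lambda>\<omega>. g (\<tau> l \<omega>)) (G 1 - G 0)"
proof -
  have [measurable]: "g \<in> borel_measurable borel"
    by (rule borel_measurable_continuous_onI[OF cont])
  note [measurable] = measurable_tau[OF \<open>l \<ge> 1\<close>]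
  have isCont: "isCont g t" for t
    using cont by (simp add: continuous_on_eq_continuous_at)
  have "has_bochner_integral lborel (\<lambda>t. g t * indicator {0..1} t) (G 1 - G 0)"
    by (intro has_bochner_integral_FTC_Icc_real deriv isCont) auto
  then have "has_bochner_integral (density lborel (indicator {0..1})) g (G 1 - G 0)"
    by (intro has_bochner_integral_density[where f = g and g = "indicator {0..1}",
          unfolded ennreal_indicator])
       (simp_all add: mult.commute)
  \<comment> \<open>The density of the uniform law is the indicator divided by the length of [0,1],
    which is 1.\<close>
  also have "density lborel (indicator {0..1::real}) = distr M borel (\<tau> l)"
    unfolding uniform[OF \<open>l \<ge> 1\<close>] uniform_measure_def
    by (intro density_cong) (auto split: split_indicator)
  finally show ?thesis
    by (simp add: has_bochner_integral_iff integrable_distr_eq integral_distr)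
qed

context
  fixes r :: nat and z :: complex and q :: real
  assumes mean_square: "\<And>l. l \<ge> 1 \<Longrightarrow>
    has_bochner_integral M (\<lambda>\<omega>. (norm (rtaylor_f r z (\<tau> l \<omega>)))\<^sup>2) q"
begin

text \<open>The squared norm is \<open>(norm \<eta>)\<^sup>2\<close> times a product of k
  independent factors, since each factor is a Borel function of one \<open>\<tau> l\<close>. The
  mean of the product is thus the product of the means, each equal to q.\<close>

lemma has_bochner_integral_norm_rtaylor_v_squared:
  "has_bochner_integral M (\<lambda>\<omega>. (norm (rtaylor_v \<tau> \<eta> r z k \<omega>))\<^sup>2) ((norm \<eta>)\<^sup>2 * q ^ k)"
proof -
  have [measurable]: "rtaylor_f r z \<in> borel_measurable borel"
    by (rule borel_measurable_continuous_onI[OF continuous_on_rtaylor_f])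
  have ind: "indep_vars (\<lambda>_. borel) (\<lambda>l \<omega>. (norm (rtaylor_f r z (\<tau> l \<omega>)))\<^sup>2) {1..k}"
    by (rule indep_vars_compose2[OF indep_vars_subset[OF indep]]) auto
  have int: "integrable M (\<lambda>\<omega>. (norm (rtaylor_f r z (\<tau> l \<omega>)))\<^sup>2)" if "l \<in> {1..k}" for l
    using mean_square[of l] that by (auto simp: has_bochner_integral_iff)
  have "(\<integral>\<omega>. (\<Prod>l=1..k. (norm (rtaylor_f r z (\<tau> l \<omega>)))\<^sup>2) \<partial>M) =
      (\<Prod>l=1..k. \<integral>\<omega>. (norm (rtaylor_f r z (\<tau> l \<omega>)))\<^sup>2 \<partial>M)"
    by (intro indep_vars_lebesgue_integral ind int) auto
  also have "\<dots> = (\<Prod>l=1..k. q)"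
    by (intro prod.cong) (use mean_square in \<open>auto simp: has_bochner_integral_iff\<close>)
  \<comment> \<open>The equation of integrals does not yield integrability, as a non-integrable
    function has integral 0 by convention. Independence supplies integrability of the product
    separately.\<close>
  finally have "has_bochner_integral M
      (\<lambda>\<omega>. \<Prod>l=1..k. (norm (rtaylor_f r z (\<tau> l \<omega>)))\<^sup>2) (q ^ k)"
    using indep_vars_integrable[OF _ ind int] by (simp add: has_bochner_integral_iff)
  then show ?thesis
    unfolding norm_rtaylor_v_squared by (rule has_bochner_integral_mult_right)
qed

text \<open>Turns \<open>q < 1\<close> into |q| < 1, as required for geometric sequences and
  series.\<close>

lemma mean_square_nonneg: "q \<ge> 0"
  using mean_square[of 1] Bochner_Integration.integral_nonneg[of M "\<lambda>\<omega>. (norm (rtaylor_f r z (\<tau> 1 \<omega>)))\<^sup>2"]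
  by (simp add: has_bochner_integral_iff)

lemma region_MS_I:
  assumes "q < 1"
  shows "z \<in> region_MS M \<tau> \<eta> r"
proof -
  have [measurable]: "rtaylor_f r z \<in> borel_measurable borel"
    by (rule borel_measurable_continuous_onI[OF continuous_on_rtaylor_f])
  \<comment> \<open>The product starts at l = 1, so only variables covered by
    \<open>measurable_tau\<close> occur.\<close>
  have "rtaylor_v \<tau> \<eta> r z k \<in> borel_measurable M" for k
    unfolding rtaylor_v_def[abs_def]
    by (intro borel_measurable_times borel_measurable_const borel_measurable_prod
          measurable_compose[OF measurable_tau]) auto
  moreover have "(\<lambda>k. (norm \<eta>)\<^sup>2 * q ^ k) \<longlonglongrightarrow> 0"
    using mean_square_nonneg \<open>q < 1\<close> by (intro tendsto_mult_right_zero LIMSEQ_power_zero) auto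
  ultimately show ?thesis
    using has_bochner_integral_norm_rtaylor_v_squared[of \<eta>]
    by (simp add: region_MS_def tendsto_L2_def square_integrable_def has_bochner_integral_iff)
qed

text \<open>Convergence in mean square alone would give almost sure convergence only along a
  subsequence. The geometric rate makes the mean squares summable, which gives it for the whole
  sequence.\<close>

lemma region_AS_I:
  assumes "q < 1"
  shows "z \<in> region_AS M \<tau> \<eta> r"
proof -
  have "summable (\<lambda>k. (norm \<eta>)\<^sup>2 * q ^ k)"
    using mean_square_nonneg \<open>q < 1\<close> by (intro summable_mult summable_geometric) auto
  then have "AE \<omega> in M. (\<lambda>k. (norm (rtaylor_v \<tau> \<eta> r z k \<omega>))\<^sup>2) \<longlonglongrightarrow> 0"
    using has_bochner_integral_norm_rtaylor_v_squared[of \<eta>]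
    by (intro integral_suminf_AE_tendsto_0) (auto simp: has_bochner_integral_iff)
  then show ?thesis
    unfolding region_AS_def mem_Collect_eq
    by eventually_elim (simp add: tendsto_norm_zero_iff)
qed

end

lemma mean_square_rtaylor_f_1_i:
  assumes "l \<ge> 1"
  shows "has_bochner_integral M (\<lambda>\<omega>. (norm (rtaylor_f 1 \<i> (\<tau> l \<omega>)))\<^sup>2) (29/30)"
proof -
  \<comment> \<open>Here f(t) = 1/2 + (1 - t^2/2) \<i>.\<close>
  have eq: "(norm (rtaylor_f 1 \<i> t))\<^sup>2 = 1/4 + (1 - t\<^sup>2/2)\<^sup>2" for t
    unfolding cmod_power2 by (simp add: rtaylor_f_def eval_nat_numeral)
  \<comment> \<open>An antiderivative of the expanded square norm 5/4 - t^2 + t^4/4, with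
    \<open>G 0 = 0\<close> and \<open>G 1 = 29/30\<close>.\<close>
  define G :: "real \<Rightarrow> real" where "G t = 5/4 * t - t^3/3 + t^5/20" for t
  have "(G has_real_derivative 1/4 + (1 - t\<^sup>2/2)\<^sup>2) (at t)" for t
    unfolding G_def
    by (rule derivative_eq_intros refl | simp)+ (simp add: power2_eq_square field_simps eval_nat_numeral)
  then have "has_bochner_integral M (\<lambda>\<omega>. 1/4 + (1 - (\<tau> l \<omega>)\<^sup>2/2)\<^sup>2) (G 1 - G 0)"
    using assms by (intro has_bochner_integral_tau continuous_intros) auto
  then show ?thesis
    unfolding eq by (simp add: G_def)
qed

end

text \<open>The cubic Taylor polynomial of exp at \<i> is 1/2 + (5/6) \<i>, of squared modulus
  17/18.\<close>

lemma i_in_region_ref_1: "\<i> \<in> region_ref 1"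
proof -
  \<comment> \<open>The upper limit stays unevaluated as \<open>1+2\<close>, so that it matches the
    unfolded \<open>region_ref 1\<close> literally.\<close>
  have "(\<Sum>j=0..1+2. \<i> ^ j / fact j) = Complex (1/2) (5/6)"
    by (simp add: complex_eq_iff eval_nat_numeral)
  moreover have "norm (Complex (1/2) (5/6)) < 1"
    unfolding complex_norm by (simp add: power2_eq_square)
  ultimately show ?thesis
    unfolding region_ref_def mem_Collect_eq by (simp only:)
qed

theorem mainTheorem6:
  fixes M :: "'a measure" and \<tau> :: "nat \<Rightarrow> 'a \<Rightarrow> real" and \<eta> :: complex
  assumes "prob_space M"
    and "prob_space.indep_vars M (\<lambda>_. borel) \<tau> {1..}"
    and "\<And>l. l \<ge> 1 \<Longrightarrow> distr M borel (\<tau> l) = uniform_measure lborel {0..1}"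
    and "\<eta> \<noteq> 0"
  shows "\<exists>r::nat. \<not> region_ref r \<subseteq> left_half_plane
            \<and> \<not> region_MS M \<tau> \<eta> r \<subseteq> left_half_plane
            \<and> \<not> region_AS M \<tau> \<eta> r \<subseteq> left_half_plane"
proof -
  interpret iid_uniform M \<tau>
    using assms(1-3) by (simp add: iid_uniform_def iid_uniform_axioms_def)
  have "\<i> \<in> region_MS M \<tau> \<eta> 1" "\<i> \<in> region_AS M \<tau> \<eta> 1"
    by (rule region_MS_I[OF mean_square_rtaylor_f_1_i] region_AS_I[OF mean_square_rtaylor_f_1_i];
        simp)+
  \<comment> \<open>The point \<i>, common to all three regions, has real part 0 and is excluded by
    the strict inequality.\<close>
  moreover have "\<i> \<notin> left_half_plane"
    by (simp add: left_half_plane_def)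
  ultimately show ?thesis
    using i_in_region_ref_1 by blast
qed

end
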